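(* Let $1\le p\le q<+\infty$. Let $E$ be a Banach space when $p=1$, and a normed space when $p>1$. Let $f\colon E\to E$ and assume that the composition operator $C_f$ maps $bv_p(E)$ into $bv_q(E)$. Let $\alpha\in(0,1)$. Then $C_f\colon bv_p(E)\to bv_q(E)$ is Hölder continuous with exponent $\alpha$ if and only if $f$ is a constant map.
   Context: $E$ is over $\mathbb R$ or $\mathbb C$ with norm $\|\cdot\|$. For a map $f\colon E\to E$, the composition operator $C_f$ assigns to a sequence $x\colon\mathbb N\to E$ the sequence $C_f(x)$ with $C_f(x)(n)=f(x(n))$ for all $n\in\mathbb N$. For $p\in[1,+\infty)$, $bv_p(E)$ is the space of all sequences $x\colon\mathbb N\to E$ with $\sum_{n=1}^\infty\|x(n+1)-x(n)\|^p<+\infty$, with norm $\|x\|_{bv_p}=\|x(1)\|+\bigl(\sum_{n=1}^\infty\|x(n+1)-x(n)\|^p\bigr)^{1/p}$. A map $F\colon X\to Y$ between normed spaces is Hölder continuous with exponent $\alpha$ if there exists $L\ge0$ such that $\|F(x)-F(y)\|_Y\le L\|x-y\|_X^\alpha$ for all $x,y\in X$. *)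

theory Defs
  imports "HOL-Analysis.Analysis"
begin

(* Sequences indexed by 1, 2, 3, ... are functions on nat shifted by one: x 0 is the first term. *)

definition bv :: "real \<Rightarrow> (nat \<Rightarrow> 'a::real_normed_vector) set" where
  "bv p = {x. summable (\<lambda>n. norm (x (Suc n) - x n) powr p)}"

definition bv_norm :: "real \<Rightarrow> (nat \<Rightarrow> 'a::real_normed_vector) \<Rightarrow> real" where
  "bv_norm p x = norm (x 0) + (\<Sum>n. norm (x (Suc n) - x n) powr p) powr (1 / p)"

definition comp_op :: "('a \<Rightarrow> 'b) \<Rightarrow> (nat \<Rightarrow> 'a) \<Rightarrow> nat \<Rightarrow> 'b" where
  "comp_op f x = (\<lambda>n. f (x n))"

(* The normed spaces are given by a carrier X and norm functions; differences of
   sequences are pointwise.  Since 0 powr a = 0, the usual reading of 0 to a positive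
   power is respected. *)

definition holder_continuous ::
  "'u::minus set \<Rightarrow> ('u \<Rightarrow> real) \<Rightarrow> ('v::minus \<Rightarrow> real) \<Rightarrow> real \<Rightarrow> ('u \<Rightarrow> 'v) \<Rightarrow> bool" where
  "holder_continuous X norm_X norm_Y \<alpha> F \<longleftrightarrow>
     (\<exists>L\<ge>0. \<forall>x\<in>X. \<forall>y\<in>X. norm_Y (F x - F y) \<le> L * norm_X (x - y) powr \<alpha>)"

(* Hence bv_norm is never applied to a divergent series in a difference of elements of bv p. *)

lemma bv_diff:
  fixes x y :: "nat \<Rightarrow> 'a::real_normed_vector"
  assumes "p \<ge> 1" "x \<in> bv p" "y \<in> bv p"
  shows "x - y \<in> bv p"
proof -
  let ?a = "\<lambda>n. norm (x (Suc n) - x n)" and ?b = "\<lambda>n. norm (y (Suc n) - y n)"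
  have le: "norm (norm ((x - y) (Suc n) - (x - y) n) powr p)
      \<le> 2 powr p * (?a n powr p + ?b n powr p)" for n
  proof -
    have "(x - y) (Suc n) - (x - y) n = (x (Suc n) - x n) - (y (Suc n) - y n)"
      by simp
    then have "norm ((x - y) (Suc n) - (x - y) n) \<le> ?a n + ?b n"
      by (metis norm_triangle_ineq4)
    also have "\<dots> \<le> 2 * max (?a n) (?b n)"
      by simp
    finally have "norm ((x - y) (Suc n) - (x - y) n) powr p \<le> (2 * max (?a n) (?b n)) powr p"
      using assms(1) by (intro powr_mono2) auto
    also have "\<dots> = 2 powr p * max (?a n) (?b n) powr p"
      by (simp add: powr_mult)
    also have "\<dots> \<le> 2 powr p * (?a n powr p + ?b n powr p)"
      by (intro mult_left_mono) (auto simp: max_def)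
    finally show ?thesis
      by simp
  qed
  have "summable (\<lambda>n. 2 powr p * (?a n powr p + ?b n powr p))"
    using assms(2,3) unfolding bv_def by (intro summable_mult summable_add) auto
  then have "summable (\<lambda>n. norm ((x - y) (Suc n) - (x - y) n) powr p)"
    by (rule summable_comparison_test'[where N = 0]) (rule le)
  then show ?thesis
    unfolding bv_def by blast
qed

end

theory Submission
  imports Defs "HOL-Real_Asymp.Real_Asymp"
begin

text \<open>Let a sequence alternate \<open>N\<close> times between \<open>a\<close> and \<open>b\<close>, and shift it by a constant \<open>h\<close>. The two
  sequences have distance \<open>\<parallel>h\<parallel>\<close>, whatever \<open>N\<close> is, while their images under \<open>C\<^sub>f\<close> have distance at least
  \<open>N\<^bsup>1/q\<^esup> \<parallel>(f (b + h) - f b) - (f (a + h) - f a)\<parallel>\<close>. So a Hoelder estimate makes \<open>f - f 0\<close> additive. An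
  additive map that grows at most like \<open>\<parallel>x\<parallel>\<^sup>\<alpha>\<close> with \<open>\<alpha> < 1\<close> vanishes.\<close>

definition alternating :: "nat \<Rightarrow> 'a \<Rightarrow> 'a \<Rightarrow> nat \<Rightarrow> 'a" where
  "alternating N a b n = (if n \<le> N \<and> odd n then b else a)"

lemma comp_op_alternating: "comp_op f (alternating N a b) = alternating N (f a) (f b)"
  by (auto simp: comp_op_def alternating_def)

lemma alternating_diff:
  "alternating N a b - alternating N c d = alternating N (a - c) (b - d)"
  by (auto simp: alternating_def)

lemma alternating_same: "alternating N a a = (\<lambda>_. a)"
  by (auto simp: alternating_def)

text \<open>The cut-off at \<open>N\<close> serves this purpose: past index \<open>N\<close> the
  sequence stays at \<open>a\<close>, so only finitely many increments are nonzero, whatever the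
  exponent.\<close>

lemma alternating_in_bv: "alternating N a b \<in> bv p"
proof -
  have "norm (alternating N a b (Suc n) - alternating N a b n) powr p = 0" if "n \<notin> {..N}" for n
    using that by (auto simp: alternating_def)
  then show ?thesis
    unfolding bv_def by (blast intro: summable_finite[of "{..N}"])
qed

lemma bv_norm_const: "bv_norm p (\<lambda>_. c) = norm c"
  by (simp add: bv_norm_def)

text \<open>The increments at indices \<open>n < N\<close> all have norm
  \<open>norm (b - a)\<close>. Only a lower bound is claimed: the norm of the first term is dropped,
  and so is the jump back to \<open>a\<close> at index \<open>N\<close>, which occurs when
  \<open>N\<close> is odd.\<close>

lemma bv_norm_alternating_ge:
  assumes "q > 0"
  shows "real N powr (1 / q) * norm (b - a) \<le> bv_norm q (alternating N a b)"
proof -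
  let ?d = "\<lambda>n. norm (alternating N a b (Suc n) - alternating N a b n) powr q"
  have "real N * norm (b - a) powr q = (\<Sum>n<N. ?d n)"
  proof -
    have "?d n = norm (b - a) powr q" if "n < N" for n
      using that by (auto simp: alternating_def norm_minus_commute)
    then show ?thesis by simp
  qed
  also have "\<dots> \<le> (\<Sum>n. ?d n)"
    using alternating_in_bv[of N a b q] by (intro sum_le_suminf) (auto simp: bv_def)
  finally have "(real N * norm (b - a) powr q) powr (1 / q) \<le> (\<Sum>n. ?d n) powr (1 / q)"
    using assms by (intro powr_mono2) auto
  moreover have "(real N * norm (b - a) powr q) powr (1 / q) = real N powr (1 / q) * norm (b - a)"
    using assms by (simp add: powr_mult powr_powr)
  ultimately show ?thesis
    by (simp add: bv_norm_def add_increasing)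
qed

text \<open>A positive \<open>c\<close> would make the left side unbounded in \<open>n\<close>. This
  ends both limit arguments below, with \<open>s = 1 / q\<close> and with
  \<open>s = 1 - \<alpha>\<close>.\<close>

lemma powr_bounded_imp_zero:
  fixes c K s :: real
  assumes "s > 0" "c \<ge> 0" and le: "\<And>n::nat. real n powr s * c \<le> K"
  shows "c = 0"
proof (rule ccontr)
  assume "c \<noteq> 0"
  with \<open>c \<ge> 0\<close> have "c > 0" by simp
  have "filterlim (\<lambda>n. real n powr s) at_top sequentially"
    using \<open>s > 0\<close> by real_asymp
  then have "\<forall>\<^sub>F n in sequentially. real n powr s > K / c"
    unfolding filterlim_at_top_dense by blast
  then obtain n where "real n powr s > K / c"
    using eventually_happens by force
  with \<open>c > 0\<close> have "real n powr s * c > K"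
    by (simp add: divide_less_eq)
  with le[of n] show False by simp
qed

lemma holder_continuous_imp_increments_eq:
  fixes f :: "'a::real_normed_vector \<Rightarrow> 'b::real_normed_vector"
  assumes "q > 0" "holder_continuous (bv p) (bv_norm p) (bv_norm q) \<alpha> (comp_op f)"
  shows "f (b + h) - f b = f (a + h) - f a"
proof -
  obtain L where L: "\<And>x y. x \<in> bv p \<Longrightarrow> y \<in> bv p \<Longrightarrow>
      bv_norm q (comp_op f x - comp_op f y) \<le> L * bv_norm p (x - y) powr \<alpha>"
    using assms(2) unfolding holder_continuous_def by blast
  let ?v = "(f (b + h) - f b) - (f (a + h) - f a)"
  have "real N powr (1 / q) * norm ?v \<le> L * norm h powr \<alpha>" for N
  proof -
    let ?x = "alternating N (a + h) (b + h)" and ?y = "alternating N a b"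
    have "real N powr (1 / q) * norm ?v \<le> bv_norm q (comp_op f ?x - comp_op f ?y)"
      unfolding comp_op_alternating alternating_diff
      by (rule bv_norm_alternating_ge[OF \<open>q > 0\<close>])
    also have "\<dots> \<le> L * bv_norm p (?x - ?y) powr \<alpha>"
      by (intro L alternating_in_bv)
    also have "?x - ?y = (\<lambda>_. h)"
      by (simp add: alternating_diff alternating_same)
    finally show ?thesis
      by (simp add: bv_norm_const)
  qed
  then have "norm ?v = 0"
    using \<open>q > 0\<close> by (intro powr_bounded_imp_zero[of "1 / q"]) auto
  then show ?thesis by simp
qed

text \<open>On constant sequences \<open>bv_norm\<close> reduces to the norm of the value, so the
  estimate for the operator passes to \<open>f\<close> itself.\<close>

lemma holder_continuous_comp_op_norm_diff_le:
  fixes f :: "'a::real_normed_vector \<Rightarrow> 'b::real_normed_vector"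
  assumes "holder_continuous (bv p) (bv_norm p) (bv_norm q) \<alpha> (comp_op f)"
  obtains L where "\<And>a b. norm (f a - f b) \<le> L * norm (a - b) powr \<alpha>"
proof -
  obtain L where L: "\<And>x y. x \<in> bv p \<Longrightarrow> y \<in> bv p \<Longrightarrow>
      bv_norm q (comp_op f x - comp_op f y) \<le> L * bv_norm p (x - y) powr \<alpha>"
    using assms unfolding holder_continuous_def by blast
  have "norm (f a - f b) \<le> L * norm (a - b) powr \<alpha>" for a b
    using L[of "\<lambda>_. a" "\<lambda>_. b"]
    by (simp add: bv_def comp_op_def fun_diff_def bv_norm_const)
  then show ?thesis by (rule that)
qed

text \<open>With g = f - f 0, equal increments give g(n x) = n g(x), while the growth bound allows
  g(n x) only order n^\<alpha>. Dividing by n^\<alpha> leaves n^(1-\<alpha>) times the norm of g(x)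
  bounded in n.\<close>

lemma equal_increments_sublinear_imp_const:
  fixes f :: "'a::real_normed_vector \<Rightarrow> 'b::real_normed_vector"
  assumes "\<alpha> < 1"
    and incr: "\<And>a b h. f (b + h) - f b = f (a + h) - f a"
    and le: "\<And>x. norm (f x - f 0) \<le> L * norm x powr \<alpha>"
  shows "f x = f 0"
proof -
  have mult: "f (real n *\<^sub>R x) - f 0 = real n *\<^sub>R (f x - f 0)" for n
  proof (induction n)
    case (Suc n)
    have "f (real (Suc n) *\<^sub>R x) - f 0 = (f (real n *\<^sub>R x) - f 0) + (f x - f 0)"
      \<comment> \<open>The increment by \<open>x\<close> is the same at
        \<open>real n *\<^sub>R x\<close> as at 0.\<close>
      using incr[of "real n *\<^sub>R x" x 0] by (simp add: algebra_simps)
    then show ?case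
      by (simp only: Suc of_nat_Suc scaleR_add_left scaleR_one add.commute)
  qed simp
  have "real n powr (1 - \<alpha>) * norm (f x - f 0) \<le> L * norm x powr \<alpha>" for n
  proof (cases "n = 0")
    case True
    then show ?thesis
      \<comment> \<open>The left side is 0 because \<open>0 powr (1 - \<alpha>) = 0\<close>. The
        sign of \<open>L\<close> is not assumed, so the right side is nonnegative only because it
        bounds a norm.\<close>
      using order_trans[OF norm_ge_zero le[of x]] by simp
  next
    case False
    then have "real n powr \<alpha> * (real n powr (1 - \<alpha>) * norm (f x - f 0)) = norm (f (real n *\<^sub>R x) - f 0)"
      by (simp add: mult flip: mult.assoc powr_add)
    also have "\<dots> \<le> real n powr \<alpha> * (L * norm x powr \<alpha>)"
      using le[of "real n *\<^sub>R x"] by (simp add: powr_mult mult_ac)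
    finally show ?thesis
      using False by simp
  qed
  then have "norm (f x - f 0) = 0"
    using \<open>\<alpha> < 1\<close> by (intro powr_bounded_imp_zero[of "1 - \<alpha>"]) auto
  then show ?thesis by simp
qed

theorem theorem39:
  fixes f :: "'a::real_normed_vector \<Rightarrow> 'a" and p q \<alpha> :: real
  assumes "1 \<le> p" and "p \<le> q"
    and "p = 1 \<Longrightarrow> complete (UNIV :: 'a set)"
    and "\<forall>x \<in> bv p. comp_op f x \<in> bv q"
    and "0 < \<alpha>" and "\<alpha> < 1"
  shows "holder_continuous (bv p) (bv_norm p) (bv_norm q) \<alpha> (comp_op f) \<longleftrightarrow> f constant_on UNIV"
proof
  assume holder: "holder_continuous (bv p) (bv_norm p) (bv_norm q) \<alpha> (comp_op f)"
  obtain L where L: "\<And>a b. norm (f a - f b) \<le> L * norm (a - b) powr \<alpha>"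
    using holder_continuous_comp_op_norm_diff_le[OF holder] by blast
  have "f x = f 0" for x
  proof (rule equal_increments_sublinear_imp_const[OF \<open>\<alpha> < 1\<close>])
    show "f (b + h) - f b = f (a + h) - f a" for a b h
      using assms(1,2) by (intro holder_continuous_imp_increments_eq[OF _ holder]) simp
    show "norm (f x - f 0) \<le> L * norm x powr \<alpha>" for x
      using L[of x 0] by simp
  qed
  then show "f constant_on UNIV"
    unfolding constant_on_def by blast
next
  assume "f constant_on UNIV"
  then obtain c where "\<And>x. f x = c"
    unfolding constant_on_def by blast
  \<comment> \<open>All images coincide, so every \<open>L \<ge> 0\<close> is a Hoelder
    constant.\<close>
  then have "comp_op f x - comp_op f y = (\<lambda>_. 0)" for x y
    by (auto simp: comp_op_def)
  then show "holder_continuous (bv p) (bv_norm p) (bv_norm q) \<alpha> (comp_op f)"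
    unfolding holder_continuous_def by (auto simp: bv_norm_const)
qed

end
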